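(* Let $m\geq 1$ be an integer and let $G$ be a finite simple graph of order $n$, containing at least three pairwise nonadjacent vertices, with vertex connectivity $\kappa(G)\geq 2m+1$. If $\sigma_3(G)\geq n+2m$, then $G$ is a $(P_{\geq 3},m)$-factor deleted graph.
   Context: All graphs are finite and simple. The order of a graph is its number of vertices, $d_G(x)$ is the degree of the vertex $x$ in $G$, and $\kappa(G)$ denotes the vertex connectivity of $G$ (with $\kappa(K_n)=n-1$). For a graph $G$ containing at least $k$ independent (pairwise nonadjacent) vertices, the degree sum is $$\sigma_k(G)=\min\Big\{\sum_{x\in X}d_G(x): X\subseteq V(G) \text{ is an independent set with } |X|=k\Big\}.$$ A $P_{\geq k}$-factor of a graph $G$ (for an integer $k\geq 2$) is a spanning subgraph of $G$ each of whose components is isomorphic to a path of order at least $k$. A graph $G$ is a $(P_{\geq k},m)$-factor deleted graph if $G-E'$ has a $P_{\geq k}$-factor for every $E'\subseteq E(G)$ with $|E'|=m$, where $G-E'$ is the graph obtained from $G$ by deleting the edges in $E'$ (keeping all vertices). *)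

theory Defs
  imports Main "HOL-Library.Ramsey"
begin

datatype 'a ugraph = Graph (verts: "'a set") (edges: "'a set set")

definition finite_simple_graph :: "'a ugraph \<Rightarrow> bool" where
  "finite_simple_graph G \<longleftrightarrow> finite (verts G) \<and> edges G \<subseteq> [verts G]\<^bsup>2\<^esup>"

definition graph_order :: "'a ugraph \<Rightarrow> nat" where
  "graph_order G = card (verts G)"

definition vertex_degree :: "'a ugraph \<Rightarrow> 'a \<Rightarrow> nat" where
  "vertex_degree G x = card {e \<in> edges G. x \<in> e}"

definition independent_set :: "'a ugraph \<Rightarrow> 'a set \<Rightarrow> bool" where
  "independent_set G X \<longleftrightarrow> X \<subseteq> verts G \<and> indep X (edges G)"

text \<open>A minimum over an empty set is unspecified, so \<open>degree_sum k G\<close> is meaningful only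
  if \<open>G\<close> has an independent set of size \<open>k\<close>.\<close>

definition degree_sum :: "nat \<Rightarrow> 'a ugraph \<Rightarrow> nat" where
  "degree_sum k G =
     Min {\<Sum>x\<in>X. vertex_degree G x | X. independent_set G X \<and> card X = k}"

definition delete_edges :: "'a ugraph \<Rightarrow> 'a set set \<Rightarrow> 'a ugraph" where
  "delete_edges G F = Graph (verts G) (edges G - F)"

definition induced_subgraph :: "'a ugraph \<Rightarrow> 'a set \<Rightarrow> 'a ugraph" where
  "induced_subgraph G W = Graph (verts G \<inter> W) {e \<in> edges G. e \<subseteq> W}"

definition delete_vertices :: "'a ugraph \<Rightarrow> 'a set \<Rightarrow> 'a ugraph" where
  "delete_vertices G S = induced_subgraph G (verts G - S)"

definition joined :: "'a ugraph \<Rightarrow> 'a \<Rightarrow> 'a \<Rightarrow> bool" where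
  "joined G u v \<longleftrightarrow> u \<in> verts G \<and> v \<in> verts G \<and> (u, v) \<in> {(x, y). {x, y} \<in> edges G}\<^sup>*"

definition graph_connected :: "'a ugraph \<Rightarrow> bool" where
  "graph_connected G \<longleftrightarrow> verts G \<noteq> {} \<and> (\<forall>u \<in> verts G. \<forall>v \<in> verts G. joined G u v)"

definition graph_components :: "'a ugraph \<Rightarrow> 'a ugraph set" where
  "graph_components G = {induced_subgraph G {v. joined G u v} | u. u \<in> verts G}"

text \<open>Least number of vertices whose removal disconnects the graph, with the value \<open>n - 1\<close>
  for the complete graph on \<open>n\<close> vertices. In a graph that is not complete, all vertices
  other than two nonadjacent ones form a cut, so the minimum is over a nonempty set. The
  choice \<open>S = verts G\<close>, which leaves the null graph, is therefore never the smallest.\<close>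

definition vertex_connectivity :: "'a ugraph \<Rightarrow> nat" where
  "vertex_connectivity G =
     (if clique (verts G) (edges G) then card (verts G) - 1
      else Min {card S | S. S \<subseteq> verts G \<and> \<not> graph_connected (delete_vertices G S)})"

definition graph_isomorphic :: "'a ugraph \<Rightarrow> 'b ugraph \<Rightarrow> bool" where
  "graph_isomorphic G H \<longleftrightarrow>
     (\<exists>f. bij_betw f (verts G) (verts H) \<and>
          (\<forall>u \<in> verts G. \<forall>v \<in> verts G. {u, v} \<in> edges G \<longleftrightarrow> {f u, f v} \<in> edges H))"

definition path_graph :: "nat \<Rightarrow> nat ugraph" where
  "path_graph l = Graph {..<l} {{i, Suc i} | i. Suc i < l}"

definition spanning_subgraph :: "'a ugraph \<Rightarrow> 'a ugraph \<Rightarrow> bool" where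
  "spanning_subgraph H G \<longleftrightarrow> verts H = verts G \<and> edges H \<subseteq> edges G"

definition path_factor :: "nat \<Rightarrow> 'a ugraph \<Rightarrow> 'a ugraph \<Rightarrow> bool" where
  "path_factor k G H \<longleftrightarrow>
     spanning_subgraph H G \<and>
     (\<forall>C \<in> graph_components H. \<exists>l \<ge> k. graph_isomorphic C (path_graph l))"

definition path_factor_deleted_graph :: "nat \<Rightarrow> nat \<Rightarrow> 'a ugraph \<Rightarrow> bool" where
  "path_factor_deleted_graph k m G \<longleftrightarrow>
     (\<forall>E'. E' \<subseteq> edges G \<and> card E' = m \<longrightarrow> (\<exists>H. path_factor k (delete_edges G E') H))"

end

theory Submission
  imports Defs "HOL-Library.Multiset"
begin

text \<open>Only the minimum degree is used of the connectivity. Cover the vertices of \<open>H = G - E'\<close>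
  by disjoint paths, minimising the sum of \<open>3 - |P|\<close> over the paths \<open>P\<close> of order less than 3,
  and suppose that some path \<open>X\<close> of the cover has at most two vertices. If \<open>u \<in> X\<close> is adjacent in
  \<open>H\<close> to a vertex \<open>s\<close> outside \<open>X\<close>, then \<open>s\<close> splits its own path as \<open>L s R\<close> with \<open>L\<close> and \<open>R\<close> of
  order 1 or 2, as otherwise rerouting improves the cover. Any two of the three wings \<open>X\<close>, \<open>L\<close>, \<open>R\<close>
  can be joined through \<open>s\<close>, leaving the third one free. Exchange arguments for the free wing show
  that the three far ends of the wings are nonadjacent in \<open>H\<close> and have at most \<open>|Q|\<close> neighbours,
  counted together, in every other path \<open>Q\<close>. So their degree sum in \<open>H\<close> is at most \<open>n\<close>. If they were
  independent in \<open>G\<close>, their degree sum in \<open>G\<close> would be at most \<open>n + m\<close>, as each edge of \<open>E'\<close> meets at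
  most one of them. Hence every such pair \<open>(u, s)\<close> is spoiled by an edge of \<open>E'\<close> between two of
  these ends. If \<open>|X| = 1\<close>, then minimality forces \<open>|L| = |R| = 1\<close>, so each edge spoils at most one of
  at least \<open>m + 1\<close> pairs; if \<open>|X| = 2\<close>, it
  spoils at most two of at least \<open>3m\<close> pairs. Both are impossible.\<close>

section \<open>Path covers and their deficiency\<close>

text \<open>The single multiset equation says at once that the paths cover \<open>V\<close>, are
  disjoint and repeat no vertex. Checking a modified cover thus reduces to a multiset
  identity.\<close>

definition path_cover :: "('a \<Rightarrow> 'a \<Rightarrow> bool) \<Rightarrow> 'a set \<Rightarrow> 'a list multiset \<Rightarrow> bool" where
  "path_cover adj V M \<longleftrightarrow>
     (\<forall>p \<in># M. p \<noteq> [] \<and> successively adj p) \<and> \<Sum>\<^sub># (image_mset mset M) = mset_set V"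

text \<open>Truncated subtraction gives paths of order at least 3 the weight 0, so only short paths
  count.\<close>

definition deficiency :: "'a list multiset \<Rightarrow> nat" where
  "deficiency M = \<Sum>\<^sub># (image_mset (\<lambda>p. 3 - length p) M)"

lemma deficiency_simps [simp]:
  "deficiency {#} = 0"
  "deficiency (add_mset p M) = (3 - length p) + deficiency M"
  "deficiency (M + N) = deficiency M + deficiency N"
  by (simp_all add: deficiency_def)

lemma multiset_two_members:
  assumes "p \<in># N" "q \<in># N" "p \<noteq> q"
  shows "\<exists>N'. N = {#p, q#} + N'"
proof -
  obtain N1 where N1: "N = add_mset p N1"
    using assms(1) by (metis multi_member_split)
  with assms have "q \<in># N1" by simp
  then obtain N2 where "N1 = add_mset q N2"
    by (metis multi_member_split)
  with N1 show ?thesis by auto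
qed

section \<open>Optimal covers and the exchange principle\<close>

locale optimal_path_cover =
  fixes V :: "'a set" and adj :: "'a \<Rightarrow> 'a \<Rightarrow> bool" and M :: "'a list multiset"
  assumes finite_V: "finite V"
    and adj_sym: "adj u v \<Longrightarrow> adj v u"
    and adj_irrefl: "\<not> adj v v"
    and adj_V: "adj u v \<Longrightarrow> v \<in> V"
    and cover: "path_cover adj V M"
    and optimal: "path_cover adj V N \<Longrightarrow> deficiency M \<le> deficiency N"
begin

abbreviation path :: "'a list \<Rightarrow> bool" where
  "path p \<equiv> p \<noteq> [] \<and> successively adj p"

lemma adj_commute: "adj u v \<longleftrightarrow> adj v u"
  using adj_sym by blast

declare successively_rev [simp del]

text \<open>Replaces the simp rule \<open>successively_rev\<close>, which would turn
  \<open>adj\<close> into its converse.\<close>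

lemma successively_rev_adj [simp]: "successively adj (rev p) \<longleftrightarrow> successively adj p"
proof -
  have "(\<lambda>x y. adj y x) = adj"
    by (auto simp: fun_eq_iff adj_commute)
  then show ?thesis
    by (simp only: successively_rev)
qed

lemma path_mem: "p \<in># M \<Longrightarrow> path p"
  using cover by (auto simp: path_cover_def)

lemma vertices_eq: "\<Sum>\<^sub># (image_mset mset M) = mset_set V"
  using cover by (simp add: path_cover_def)

text \<open>Deficiency is additive, so optimality can be tested on the exchanged paths alone. The
  later improvement arguments all contradict this inequality.\<close>

lemma exchange:
  assumes "M = old + rest" "\<forall>p \<in># new. path p"
    and "\<Sum>\<^sub># (image_mset mset new) = \<Sum>\<^sub># (image_mset mset old)"
  shows "deficiency old \<le> deficiency new"
proof -
  have "path_cover adj V (new + rest)"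
    using assms cover by (auto simp: path_cover_def)
  from optimal[OF this] show ?thesis
    using assms(1) by simp
qed

lemma mset_path_le: "p \<in># M \<Longrightarrow> mset p \<subseteq># mset_set V"
  unfolding vertices_eq[symmetric] by (metis image_mset_add_mset mset_subset_eq_add_left multi_member_split sum_mset.add_mset)

lemma set_path: "p \<in># M \<Longrightarrow> set p \<subseteq> V"
  using mset_path_le[of p] finite_V by (metis elem_mset_set mset_subset_eqD set_mset_mset subsetI)

lemma distinct_path: "p \<in># M \<Longrightarrow> distinct p"
proof -
  assume "p \<in># M"
  from mset_path_le[OF this] have "count (mset p) v \<le> 1" for v
    by (metis count_mset_set' le_trans mset_subset_eq_count order_refl zero_le_one)
  then have "count (mset p) v = (if v \<in> set p then 1 else 0)" for v
    by (metis count_mset_0_iff le_antisym less_one linorder_not_less)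
  then show ?thesis
    by (simp add: distinct_count_atmost_1)
qed

lemma path_containing: "v \<in> V \<Longrightarrow> \<exists>p \<in># M. v \<in> set p"
proof -
  assume "v \<in> V"
  then have "v \<in># \<Sum>\<^sub># (image_mset mset M)"
    using finite_V by (simp add: vertices_eq)
  then show ?thesis by auto
qed

lemma path_unique:
  assumes "p \<in># M" "q \<in># M" "v \<in> set p" "v \<in> set q"
  shows "p = q"
proof (rule ccontr)
  assume "p \<noteq> q"
  with assms obtain M' where M: "M = {#p, q#} + M'"
    using multiset_two_members[of p M q] by blast
  have "count (mset_set V) v \<ge> count (mset p) v + count (mset q) v"
    unfolding vertices_eq[symmetric] M by simp
  moreover have "count (mset p) v > 0" "count (mset q) v > 0"
    using assms by (auto simp: count_mset_gt_0)
  moreover have "count (mset_set V) v \<le> 1"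
    by (simp add: count_mset_set')
  ultimately show False by linarith
qed

text \<open>\<open>N\<close> and \<open>W\<close> are a rearrangement of the vertices of \<open>old\<close> in which \<open>W\<close> is the only path that may
  be short; \<open>W\<close> need not be a member of the cover, nor as long as the short path in \<open>old\<close>.\<close>

lemma attach:
  assumes M: "M = old + {#Q#} + rest" and old: "deficiency old \<ge> 1"
    and W: "path W" "adj (last W) y" and Q: "Q = L @ y # R"
    and N: "\<forall>p \<in># N. path p" "deficiency N = 0"
    and eq: "mset W + \<Sum>\<^sub># (image_mset mset N) = \<Sum>\<^sub># (image_mset mset old)"
  shows "1 \<le> length L" "length L \<le> 2" "1 \<le> length R" "length R \<le> 2"
proof -
  have Qp: "path Q"
    using path_mem[of Q] M by simp
  \<comment> \<open>Stated for an arbitrary split so that it also applies to the reversed path; this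
    yields the bounds on both sides of \<open>y\<close>.\<close>
  have L: "L \<noteq> [] \<and> (R \<noteq> [] \<longrightarrow> length L \<le> 2)"
    if LR: "mset Q = mset (L @ y # R)" "path (L @ y # R)" for L R
  proof (rule conjI)
    show "L \<noteq> []"
    proof
      assume "L = []"
      \<comment> \<open>If \<open>y\<close> is the first vertex of \<open>Q\<close>, then
        \<open>W\<close> can be put in front of \<open>Q\<close>, which removes the deficiency of
        \<open>old\<close>.\<close>
      then have "deficiency (old + {#Q#}) \<le> deficiency (N + {#W @ y # R#})"
        using M W N eq LR
        by (intro exchange[of _ rest]) (auto simp: successively_append_iff ac_simps)
      moreover have "length Q = Suc (length R)"
        using LR \<open>L = []\<close> by (metis append_Nil length_Cons mset_eq_length)
      ultimately show False
        using N(2) old by simp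
    qed
    show "R \<noteq> [] \<longrightarrow> length L \<le> 2"
    proof (intro impI, rule ccontr)
      assume "R \<noteq> []" "\<not> length L \<le> 2"
      \<comment> \<open>Cutting \<open>Q\<close> before \<open>y\<close> leaves the long path
        \<open>L\<close>, and \<open>W\<close>, \<open>y\<close> and \<open>R\<close> together have
        at least three vertices.\<close>
      have "deficiency (old + {#Q#}) \<le> deficiency (N + {#L, W @ y # R#})"
        using M W N eq LR \<open>\<not> length L \<le> 2\<close>
        by (intro exchange[of _ rest]) (auto simp: successively_append_iff successively_Cons ac_simps)
      moreover have "length W \<ge> 1" "length R \<ge> 1"
        using W \<open>R \<noteq> []\<close> by (simp_all add: Suc_le_eq)
      ultimately show False
        using N(2) old \<open>\<not> length L \<le> 2\<close> by simp
    qed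
  qed
  have 1: "L \<noteq> []" "R \<noteq> [] \<longrightarrow> length L \<le> 2"
    using L[of L R] Q Qp by auto
  have Qp': "path (rev Q)"
    using Qp by (metis rev_is_Nil_conv successively_rev_adj)
  have "rev R \<noteq> []" "rev L \<noteq> [] \<longrightarrow> length (rev R) \<le> 2"
    using L[of "rev R" "rev L"] Q Qp' by auto
  with 1 show "1 \<le> length L" "length L \<le> 2" "1 \<le> length R" "length R \<le> 2"
    by (auto simp: Suc_le_eq)
qed

section \<open>Stars and the degree sum of their tips\<close>

text \<open>The wings \<open>A\<close>, \<open>B\<close>, \<open>C\<close> are oriented towards \<open>s\<close>, so their far ends are \<open>hd A\<close>, \<open>hd B\<close>, \<open>hd C\<close>.
  The paths \<open>old\<close> are a short path of the cover and the one through \<open>s\<close>. Hiding them makes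
  the definition symmetric in the three wings.\<close>

definition star :: "'a \<Rightarrow> 'a list \<Rightarrow> 'a list \<Rightarrow> 'a list \<Rightarrow> 'a list multiset \<Rightarrow> bool" where
  "star s A B C rest \<longleftrightarrow>
     (\<forall>W \<in> {A, B, C}. path W \<and> length W \<le> 2 \<and> adj (last W) s) \<and>
     (\<exists>old. M = old + rest \<and> 1 \<le> deficiency old \<and>
        \<Sum>\<^sub># (image_mset mset old) = add_mset s (mset A + mset B + mset C))"

text \<open>The definition depends on the wings only through their set and the sum of their
  multisets. Together with \<open>star_swap\<close> this gives all permutations of the
  wings.\<close>

lemma star_rotate: "star s A B C rest \<Longrightarrow> star s B C A rest"
proof -
  have "{B, C, A} = {A, B, C}" "mset B + mset C + mset A = mset A + mset B + mset C"
    by (auto simp: add.commute add.left_commute)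
  then have "star s B C A rest = star s A B C rest"
    unfolding star_def by (rule arg_cong2[where f = "\<lambda>S T.
      (\<forall>W \<in> S. path W \<and> length W \<le> 2 \<and> adj (last W) s) \<and> (\<exists>old. M = old + rest \<and>
        1 \<le> deficiency old \<and> \<Sum>\<^sub># (image_mset mset old) = add_mset s T)"])
  then show "star s A B C rest \<Longrightarrow> star s B C A rest"
    by simp
qed

lemma star_swap: "star s A B C rest \<Longrightarrow> star s B A C rest"
proof -
  have "{B, A, C} = {A, B, C}" "mset B + mset A + mset C = mset A + mset B + mset C"
    by (auto simp: add.commute add.left_commute)
  then have "star s B A C rest = star s A B C rest"
    unfolding star_def by (rule arg_cong2[where f = "\<lambda>S T.
      (\<forall>W \<in> S. path W \<and> length W \<le> 2 \<and> adj (last W) s) \<and> (\<exists>old. M = old + rest \<and>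
        1 \<le> deficiency old \<and> \<Sum>\<^sub># (image_mset mset old) = add_mset s T)"])
  then show "star s A B C rest \<Longrightarrow> star s B A C rest"
    by simp
qed

lemma starE:
  assumes "star s A B C rest"
  obtains old where "M = old + rest" "1 \<le> deficiency old"
    "\<Sum>\<^sub># (image_mset mset old) = add_mset s (mset A + mset B + mset C)"
    "path A" "path B" "path C" "length A \<le> 2" "length B \<le> 2" "length C \<le> 2"
    "adj (last A) s" "adj (last B) s" "adj (last C) s"
    "adj s (last A)" "adj s (last B)" "adj s (last C)"
  using assms by (auto simp: star_def intro: adj_sym)

text \<open>Joining \<open>B\<close> and \<open>C\<close> through \<open>s\<close> makes a path of
  order at least 3. The free wing, reversed so that it ends in its tip, is then the \<open>W\<close>
  of \<open>attach\<close>.\<close>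

lemma star_attach:
  assumes "star s A B C rest" "Q \<in># rest" "Q = L @ y # R" "adj (hd A) y"
  shows "1 \<le> length L" "length L \<le> 2" "1 \<le> length R" "length R \<le> 2"
proof -
  from assms(1) obtain old where old: "M = old + rest" "1 \<le> deficiency old"
    "\<Sum>\<^sub># (image_mset mset old) = add_mset s (mset A + mset B + mset C)"
    and w: "path A" "path B" "path C" "adj (last B) s" "adj s (last C)"
    by (rule starE)
  obtain rest' where "rest = add_mset Q rest'"
    using assms(2) by (metis multi_member_split)
  then have M: "M = old + {#Q#} + rest'"
    using old by simp
  have len: "length B \<ge> 1" "length C \<ge> 1"
    using w by (simp_all add: Suc_le_eq)
  have "successively adj (B @ s # rev C)"
    using w by (auto simp: successively_append_iff successively_Cons hd_rev)
  then have N: "\<forall>p \<in># {#B @ s # rev C#}. path p" "deficiency {#B @ s # rev C#} = 0"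
    using len by auto
  have eq: "mset (rev A) + \<Sum>\<^sub># (image_mset mset {#B @ s # rev C#}) = \<Sum>\<^sub># (image_mset mset old)"
    using old by simp
  have W: "path (rev A)" "adj (last (rev A)) y"
    using w assms(4) by (simp_all add: last_rev)
  show "1 \<le> length L" "length L \<le> 2" "1 \<le> length R" "length R \<le> 2"
    using attach[OF M old(2) W assms(3) N eq] by auto
qed

lemma orient:
  assumes "path X" "length X \<le> 2" "u \<in> set X"
  obtains Z where "path Z" "last Z = u" "mset Z = mset X"
proof (cases "last X = u")
  case False
  then have "X = [u, last X]"
    using assms by (cases X; cases "tl X") auto
  then have "last (rev X) = u"
    by (metis last_rev list.sel(1))
  then show ?thesis
    using that[of "rev X"] assms by simp
qed (use that assms in blast)

text \<open>Since \<open>B\<close> has at most two vertices, it can be oriented to end in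
  \<open>y\<close>; the edge would then join all three wings and \<open>s\<close> into one long
  path. All of \<open>B\<close> is excluded, not only its tip, because the degree count relies on
  it.\<close>

lemma star_tip_nonadjacent:
  assumes "star s A B C rest" "y \<in> set B"
  shows "\<not> adj (hd A) y"
proof
  assume ay: "adj (hd A) y"
  from assms(1) obtain old where old: "M = old + rest" "1 \<le> deficiency old"
    "\<Sum>\<^sub># (image_mset mset old) = add_mset s (mset A + mset B + mset C)"
    and w: "path A" "path B" "path C" "length B \<le> 2" "adj (last C) s" "adj s (last A)"
    by (rule starE)
  obtain B' where B': "path B'" "last B' = y" "mset B' = mset B"
    using orient[OF w(2,4) assms(2)] .
  let ?p = "C @ s # rev A @ rev B'"
  have "successively adj ?p"
    using w B' ay by (auto simp: successively_append_iff successively_Cons hd_rev last_rev)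
  then have "deficiency old \<le> deficiency {#?p#}"
    using old B' by (intro exchange[of _ rest]) auto
  moreover have "length A \<ge> 1" "length C \<ge> 1" 
    using w by (simp_all add: Suc_le_eq)
  moreover have "length B' \<ge> 1"
    using B' by (simp add: Suc_le_eq)
  ultimately show False
    using old(2) by simp
qed

text \<open>Otherwise cut the path between \<open>q2\<close> and \<open>q3\<close>: the first half
  continues through \<open>A\<close>, \<open>s\<close> and \<open>C\<close>, the second half is
  extended by \<open>B\<close>, and both results are long.\<close>

lemma star_cross:
  assumes "star s A B C rest" "[q1, q2, q3, q4] \<in># rest" "adj (hd A) q2"
  shows "\<not> adj (hd B) q3"
proof
  assume bq: "adj (hd B) q3"
  from assms(1) obtain old where old: "M = old + rest" "1 \<le> deficiency old"
    "\<Sum>\<^sub># (image_mset mset old) = add_mset s (mset A + mset B + mset C)"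
    and w: "path A" "path B" "path C" "adj (last A) s" "adj s (last C)"
    by (rule starE)
  let ?Q = "[q1, q2, q3, q4]"
  obtain rest' where r: "rest = add_mset ?Q rest'"
    using assms(2) by (metis multi_member_split)
  have Q: "path ?Q"
    using path_mem[of ?Q] old r by simp
  let ?p = "[q1, q2] @ A @ s # rev C" and ?q = "rev B @ [q3, q4]"
  have p: "successively adj ?p"
    using w Q assms(3) adj_sym by (auto simp: successively_append_iff successively_Cons hd_rev)
  have q: "successively adj ?q"
    using w Q bq by (auto simp: successively_append_iff last_rev)
  have "deficiency (old + {#?Q#}) \<le> deficiency {#?p, ?q#}"
    using old r p q by (intro exchange[of _ rest']) auto
  moreover have "length A \<ge> 1" "length B \<ge> 1"
    using w by (simp_all add: Suc_le_eq)
  ultimately show False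
    using old(2) by simp
qed

definition nbrs_in :: "'a \<Rightarrow> 'a list \<Rightarrow> nat" where
  "nbrs_in v p = length (filter (adj v) p)"

text \<open>A neighbour of a tip has one or two vertices of \<open>Q\<close> on either side, so
  \<open>Q\<close> has order 3, 4 or 5. For orders 3 and 5 only the middle vertex qualifies. For
  order 4 only \<open>q2\<close> and \<open>q3\<close> do, and \<open>star_cross\<close> forbids
  different tips to use both. The count is at most 3 in each case.\<close>

lemma star_count:
  assumes st: "star s A B C rest" and Q: "Q \<in># rest"
  shows "nbrs_in (hd A) Q + nbrs_in (hd B) Q + nbrs_in (hd C) Q \<le> length Q"
proof (cases "\<exists>v \<in> {hd A, hd B, hd C}. \<exists>y \<in> set Q. adj v y")
  case False
  then have "nbrs_in v Q = 0" if "v \<in> {hd A, hd B, hd C}" for v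
    using that by (auto simp: nbrs_in_def filter_empty_conv)
  then show ?thesis by simp
next
  case True
  note sts = st star_rotate[OF st] star_rotate[OF star_rotate[OF st]]
  have resist: "1 \<le> length L \<and> length L \<le> 2 \<and> 1 \<le> length R \<and> length R \<le> 2"
    if "v \<in> {hd A, hd B, hd C}" "Q = L @ y # R" "adj v y" for v y L R
    using that sts[THEN star_attach(1), OF Q that(2)] sts[THEN star_attach(2), OF Q that(2)]
      sts[THEN star_attach(3), OF Q that(2)] sts[THEN star_attach(4), OF Q that(2)] by blast
  from True obtain v y L R where vy: "v \<in> {hd A, hd B, hd C}" "Q = L @ y # R" "adj v y"
    by (metis split_list)
  from resist[OF this] vy(2) have "length Q \<in> {3, 4, 5}" by auto
  then consider q1 q2 q3 where "Q = [q1, q2, q3]" | q1 q2 q3 q4 where "Q = [q1, q2, q3, q4]"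
    | q1 q2 q3 q4 q5 where "Q = [q1, q2, q3, q4, q5]"
    by (auto simp: numeral_eq_Suc length_Suc_conv)
  then show ?thesis
  proof cases
    case 1
    have "\<not> adj v q1" "\<not> adj v q3" if "v \<in> {hd A, hd B, hd C}" for v
      using resist[OF that, of "[]"] resist[OF that, of "[q1, q2]" _ "[]"] 1 by auto
    then show ?thesis
      using 1 by (auto simp: nbrs_in_def)
  next
    case 3
    have "\<not> adj v q1" "\<not> adj v q2" "\<not> adj v q4" "\<not> adj v q5" if "v \<in> {hd A, hd B, hd C}" for v
      using resist[OF that, of "[]"] resist[OF that, of "[q1]"] resist[OF that, of "[q1, q2, q3]"]
        resist[OF that, of "[q1, q2, q3, q4]" _ "[]"] 3 by auto
    then show ?thesis
      using 3 by (auto simp: nbrs_in_def)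
  next
    case 2
    have "\<not> adj v q1" "\<not> adj v q4" if "v \<in> {hd A, hd B, hd C}" for v
      using resist[OF that, of "[]"] resist[OF that, of "[q1, q2, q3]" _ "[]"] 2 by auto
    \<comment> \<open>The three rotations and their swaps cover all six ordered pairs of
      wings.\<close>
    moreover note sts[THEN star_cross, OF Q[unfolded 2]]
      sts[THEN star_swap, THEN star_cross, OF Q[unfolded 2]]
    ultimately show ?thesis
      using 2 by (auto simp: nbrs_in_def)
  qed
qed

text \<open>The tip has no neighbours in the other two wings. In its own wing it misses itself,
  which makes up for its possible neighbour \<open>s\<close>.\<close>

lemma star_tip_degree:
  assumes st: "star s A B C rest"
  shows "card {w. adj (hd A) w} \<le> length A + (\<Sum>Q \<in># rest. nbrs_in (hd A) Q)"
proof -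
  from st obtain old where old: "M = old + rest" "1 \<le> deficiency old"
    "\<Sum>\<^sub># (image_mset mset old) = add_mset s (mset A + mset B + mset C)"
    and w: "path A"
    by (rule starE)
  let ?F = "filter_mset (adj (hd A))"
  have F_sum: "size (?F (\<Sum>\<^sub># (image_mset mset N))) = (\<Sum>Q \<in># N. nbrs_in (hd A) Q)" for N
    by (induction N) (auto simp: nbrs_in_def simp flip: mset_filter)
  have "{w. adj (hd A) w} = {w \<in> V. adj (hd A) w}"
    using adj_V by auto
  then have "card {w. adj (hd A) w} = size (?F (mset_set V))"
    using finite_V by (simp add: filter_mset_mset_set)
  also have "\<dots> = size (?F (add_mset s (mset A + mset B + mset C))) + (\<Sum>Q \<in># rest. nbrs_in (hd A) Q)"
    unfolding vertices_eq[symmetric] old(1) by (simp add: old(3) F_sum)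
  finally have deg: "card {w. adj (hd A) w} =
    size (?F (add_mset s (mset A + mset B + mset C))) + (\<Sum>Q \<in># rest. nbrs_in (hd A) Q)" .
  have BC: "?F (mset B) = {#}" "?F (mset C) = {#}"
    using star_tip_nonadjacent[OF st] star_tip_nonadjacent[OF star_swap[OF star_rotate[OF star_rotate[OF st]]]]
    by (auto simp: filter_empty_conv simp flip: mset_filter)
  have A: "size (?F (mset A)) \<le> length A - 1"
    using w adj_irrefl[of "hd A"] by (cases A) (auto simp flip: mset_filter)
  have "length A \<ge> 1"
    using w by (simp add: Suc_le_eq)
  with deg A show ?thesis
    by (auto simp: BC)
qed

lemma star_degree_sum:
  assumes st: "star s A B C rest"
  shows "card {w. adj (hd A) w} + card {w. adj (hd B) w} + card {w. adj (hd C) w} \<le> card V"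
proof -
  from st obtain old where old: "M = old + rest" "1 \<le> deficiency old"
    "\<Sum>\<^sub># (image_mset mset old) = add_mset s (mset A + mset B + mset C)"
    by (rule starE)
  have "card V = size (\<Sum>\<^sub># (image_mset mset M))"
    by (simp add: vertices_eq)
  also have "\<dots> = Suc (length A + length B + length C) + (\<Sum>Q \<in># rest. length Q)"
  proof -
    have "size (\<Sum>\<^sub># (image_mset mset N)) = (\<Sum>Q \<in># N. length Q)" for N :: "'a list multiset"
      by (induction N) auto
    then show ?thesis
      by (simp add: old)
  qed
  finally have V: "card V = Suc (length A + length B + length C) + (\<Sum>Q \<in># rest. length Q)" .
  have "(\<Sum>Q \<in># rest. nbrs_in (hd A) Q + nbrs_in (hd B) Q + nbrs_in (hd C) Q) \<le> (\<Sum>Q \<in># rest. length Q)"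
    using star_count[OF st] by (rule sum_mset_mono)
  then show ?thesis
    using star_tip_degree[OF st] star_tip_degree[OF star_rotate[OF st]]
      star_tip_degree[OF star_rotate[OF star_rotate[OF st]]] V
    by (simp add: sum_mset.distrib)
qed

section \<open>Edges leaving a short path\<close>

text \<open>The path through \<open>s\<close> is cut at \<open>s\<close>; its two pieces and
  \<open>Z\<close> are the wings, and \<open>attach\<close> with no additional paths bounds their
  orders. The right piece is reversed to point towards \<open>s\<close>.\<close>

lemma star_at:
  assumes X: "X \<in># M" "length X \<le> 2" and Z: "path Z" "mset Z = mset X"
    and s: "adj (last Z) s" "s \<notin> set X"
  obtains L R rest where "L @ s # R \<in># M" "star s Z L (rev R) rest"
    "length X = 1 \<longrightarrow> length L = 1 \<and> length R = 1"
proof -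
  from s(1) obtain P where P: "P \<in># M" "s \<in> set P"
    using path_containing adj_V by blast
  from P(2) obtain L R where LR: "P = L @ s # R"
    by (metis split_list)
  have "P \<noteq> X"
    using P s by blast
  then obtain rest where "M = {#X, P#} + rest"
    using multiset_two_members[of X M P] X(1) P(1) by blast
  then have M: "M = {#X#} + {#P#} + rest" by simp
  have len: "length Z = length X"
    using Z by (metis mset_eq_length)
  have defX: "1 \<le> deficiency {#X#}"
    using X by simp
  have at: "1 \<le> length L" "length L \<le> 2" "1 \<le> length R" "length R \<le> 2"
    using attach[OF M defX Z(1) s(1) LR, of "{#}"] Z by auto
  have P': "path P"
    using path_mem[OF P(1)] .
  have LRp: "path L" "path R" "adj (last L) s" "adj (last (rev R)) s"
    using P' at unfolding LR
    by (auto simp: successively_append_iff successively_Cons last_rev adj_commute)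
  show thesis
  proof (rule that)
    show "L @ s # R \<in># M"
      using P LR by simp
    show "star s Z L (rev R) rest"
      unfolding star_def
    proof (intro conjI exI[of _ "{#X, P#}"])
      show "\<forall>W \<in> {Z, L, rev R}. path W \<and> length W \<le> 2 \<and> adj (last W) s"
        using Z LRp at s len X by auto
    qed (use M X Z LR in auto)
    show "length X = 1 \<longrightarrow> length L = 1 \<and> length R = 1"
    proof
      assume X1: "length X = 1"
      \<comment> \<open>A single vertex has deficiency 2. If \<open>R\<close> had two or more
        vertices, cutting it off and putting \<open>X\<close> after \<open>s\<close> would leave a
        deficiency of at most 1.\<close>
      have one: "length R \<le> 1" if "mset P = mset (L @ s # R)" "path (L @ s # R)" "length L \<ge> 1" for L R
      proof (rule ccontr)
        assume "\<not> length R \<le> 1"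
        have new: "path (L @ s # rev Z)" "path R"
          using that Z s \<open>\<not> length R \<le> 1\<close>
          by (auto simp: successively_append_iff successively_Cons hd_rev adj_commute)
        then have "deficiency ({#X#} + {#P#}) \<le> deficiency {#L @ s # rev Z, R#}"
          using M that Z by (intro exchange[of _ rest]) auto
        then show False
          using X1 len that \<open>\<not> length R \<le> 1\<close> by simp
      qed
      have "path (rev P)"
        using P' by (metis rev_is_Nil_conv successively_rev_adj)
      then show "length L = 1 \<and> length R = 1"
        using one[of L R] one[of "rev R" "rev L"] P' LR at by auto
    qed
  qed
qed

text \<open>The two vertices of \<open>X\<close> could be inserted between \<open>q2\<close> and
  \<open>q3\<close>, giving a path of order 6.\<close>

lemma bad_edge_cross:
  assumes X: "X \<in># M" "length X = 2" and Z: "path Z" "mset Z = mset X"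
    and Q: "[q1, q2, q3, q4] \<in># M" and q: "adj (hd Z) q2" "adj (last Z) q3"
  shows False
proof -
  let ?Q = "[q1, q2, q3, q4]"
  have "?Q \<noteq> X"
    using X by auto
  then obtain rest where M: "M = {#X, ?Q#} + rest"
    using multiset_two_members[of X M ?Q] X(1) Q by blast
  have "successively adj ([q1, q2] @ Z @ [q3, q4])"
    using path_mem[OF Q] Z q by (auto simp: successively_append_iff successively_Cons adj_commute)
  then have "deficiency {#X, ?Q#} \<le> deficiency {#[q1, q2] @ Z @ [q3, q4]#}"
    using M Z by (intro exchange[of _ rest]) auto
  then show False
    using X by simp
qed

text \<open>Transfers the bounds of \<open>star_at\<close> to any given split: disjointness
  determines the path through \<open>s\<close>, and distinctness determines where it is cut.\<close>

lemma resisting_path: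
  assumes X: "X \<in># M" "length X \<le> 2" and P: "P \<in># M" "P = L @ s # R"
    and us: "u \<in> set X" "s \<notin> set X" "adj u s"
  shows "1 \<le> length L \<and> length L \<le> 2 \<and> 1 \<le> length R \<and> length R \<le> 2"
proof -
  obtain Z where Z: "path Z" "last Z = u" "mset Z = mset X"
    using orient[OF path_mem[OF X(1)] X(2) us(1)] .
  from Z us obtain L' R' rest where LR: "L' @ s # R' \<in># M" "star s Z L' (rev R') rest"
    using star_at[OF X Z(1,3)] by metis
  have eq: "L @ s # R = L' @ s # R'"
    using path_unique[of P "L' @ s # R'" s] P LR by auto
  moreover have "distinct (L @ s # R)"
    using distinct_path P by blast
  ultimately have "L = L' \<and> R = R'"
    by (metis append_Cons_eq_iff distinct_append disjoint_iff distinct.simps(2) list.set_intros(1) not_distinct_conv_prefix)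
  then show ?thesis
    using LR(2) by (auto simp: star_def Suc_le_eq)
qed

text \<open>As in \<open>star_count\<close>, only the middle vertex of a path of order 3 or 5 can be
  attached, which allows two pairs. For order 4 there are four candidates, reduced to two by
  \<open>bad_edge_cross\<close> for both orientations of \<open>X\<close>.\<close>

lemma card_attachments_le:
  assumes X: "X \<in># M" "length X = 2" and P: "P \<in># M" "P \<noteq> X"
  shows "card {(u, s). u \<in> set X \<and> s \<in> set P \<and> adj u s} \<le> 2" (is "card ?K \<le> 2")
proof (cases "?K = {}")
  case True
  show ?thesis
    unfolding True by simp
next
  case False
  obtain x y where xy: "X = [x, y]"
    using X(2) by (auto simp: numeral_eq_Suc length_Suc_conv)
  have nX: "s \<notin> set X" if "s \<in> set P" for s
    using path_unique[OF P(1) X(1) that] P(2) by blast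
  have resist: "1 \<le> length L \<and> length L \<le> 2 \<and> 1 \<le> length R \<and> length R \<le> 2"
    if "u \<in> set X" "P = L @ s # R" "adj u s" for u s L R
    using resisting_path[OF X(1) _ P(1) that(2,1) _ that(3)] X(2) nX that(2) by auto
  from False obtain u s where "u \<in> set X" "s \<in> set P" "adj u s" by auto
  then obtain L R where "u \<in> set X" "P = L @ s # R" "adj u s"
    by (metis split_list)
  from resist[OF this] this(2) have "length P \<in> {3, 4, 5}" by auto
  then consider q1 q2 q3 where "P = [q1, q2, q3]" | q1 q2 q3 q4 where "P = [q1, q2, q3, q4]"
    | q1 q2 q3 q4 q5 where "P = [q1, q2, q3, q4, q5]"
    by (auto simp: numeral_eq_Suc length_Suc_conv)
  then have "\<exists>a b. ?K \<subseteq> {a, b}"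
  proof cases
    case 1
    have "\<not> adj v q1" "\<not> adj v q3" if "v \<in> set X" for v
      using resist[OF that, of "[]"] resist[OF that, of "[q1, q2]" _ "[]"] 1 by auto
    then have "?K \<subseteq> {(x, q2), (y, q2)}"
      using 1 xy by auto
    then show ?thesis by blast
  next
    case 3
    have "\<not> adj v q1" "\<not> adj v q2" "\<not> adj v q4" "\<not> adj v q5" if "v \<in> set X" for v
      using resist[OF that, of "[]"] resist[OF that, of "[q1]"] resist[OF that, of "[q1, q2, q3]"]
        resist[OF that, of "[q1, q2, q3, q4]" _ "[]"] 3 by auto
    then have "?K \<subseteq> {(x, q3), (y, q3)}"
      using 3 xy by auto
    then show ?thesis by blast
  next
    case 2
    have ends: "\<not> adj v q1" "\<not> adj v q4" if "v \<in> set X" for v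
      using resist[OF that, of "[]"] resist[OF that, of "[q1, q2, q3]" _ "[]"] 2 by auto
    have Xp: "path [x, y]" "path [y, x]"
      using path_mem[OF X(1)] xy by (auto simp: adj_commute)
    have "\<not> (adj x q2 \<and> adj y q3)" "\<not> (adj y q2 \<and> adj x q3)"
      using bad_edge_cross[OF X Xp(1) _ P(1)[unfolded 2]] bad_edge_cross[OF X Xp(2) _ P(1)[unfolded 2]] xy
      by auto
    then have cross: "\<not> adj x q2 \<or> \<not> adj y q3" "\<not> adj y q2 \<or> \<not> adj x q3"
      by blast+
    have K: "?K \<subseteq> {p \<in> {(x, q2), (x, q3), (y, q2), (y, q3)}. adj (fst p) (snd p)}"
    proof clarify
      fix u s
      assume "u \<in> set X" "s \<in> set P" "adj u s"
      then have "u = x \<or> u = y" "s = q2 \<or> s = q3"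
        using xy 2 ends[of u] by auto
      then show "(u, s) \<in> {(x, q2), (x, q3), (y, q2), (y, q3)} \<and> adj (fst (u, s)) (snd (u, s))"
        using \<open>adj u s\<close> by auto
    qed
    \<comment> \<open>The two forbidden combinations partition the four candidates, and each of them
      loses at least one pair.\<close>
    from cross consider "\<not> adj x q2" "\<not> adj y q2" | "\<not> adj x q2" "\<not> adj x q3"
      | "\<not> adj y q3" "\<not> adj y q2" | "\<not> adj y q3" "\<not> adj x q3"
      by blast
    then show ?thesis
    proof cases
      case 1
      then show ?thesis
        by (intro exI[of _ "(x, q3)"] exI[of _ "(y, q3)"] order_trans[OF K]) auto
    next
      case 2
      then show ?thesis
        by (intro exI[of _ "(y, q2)"] exI[of _ "(y, q3)"] order_trans[OF K]) auto
    next
      case 3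
      then show ?thesis
        by (intro exI[of _ "(x, q2)"] exI[of _ "(x, q3)"] order_trans[OF K]) auto
    next
      case 4
      then show ?thesis
        by (intro exI[of _ "(x, q2)"] exI[of _ "(y, q2)"] order_trans[OF K]) auto
    qed
  qed
  then obtain a b where "?K \<subseteq> {a, b}" by blast
  then have "card ?K \<le> card {a, b}"
    by (intro card_mono) auto
  also have "\<dots> \<le> 2"
    by (simp add: card_insert_if)
  finally show ?thesis .
qed

text \<open>\<open>D\<close> stands for the deleted edges. Only one of the three tips lies in
  \<open>X\<close>, so an edge between two tips meets \<open>P\<close>; this lets the edge determine
  \<open>P\<close>. If \<open>X\<close> is a single vertex, \<open>s\<close> is the middle of
  \<open>P\<close> and is determined too.\<close>

lemma spoiled_attachment:
  assumes D: "\<And>a b c. {a, b, c} \<subseteq> V \<Longrightarrow> card {a, b, c} = 3 \<Longrightarrow> \<not> adj a b \<Longrightarrow> \<not> adj a c \<Longrightarrow> \<not> adj b c \<Longrightarrow>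
      card {w. adj a w} + card {w. adj b w} + card {w. adj c w} \<le> card V \<Longrightarrow>
      {a, b} \<in> D \<or> {a, c} \<in> D \<or> {b, c} \<in> D"
    and X: "X \<in># M" "length X \<le> 2" and us: "u \<in> set X" "adj u s" "s \<notin> set X"
  shows "\<exists>e \<in> D. \<exists>P \<in># M. s \<in> set P \<and> e \<subseteq> set X \<union> set P \<and> e \<inter> set P \<noteq> {} \<and>
    (length X = 1 \<longrightarrow> length P = 3 \<and> P ! 1 = s)"
proof -
  obtain Z where Z: "path Z" "last Z = u" "mset Z = mset X"
    using orient[OF path_mem[OF X(1)] X(2) us(1)] .
  have "adj (last Z) s"
    unfolding Z(2) by (rule us(2))
  from star_at[OF X Z(1,3) this us(3)] obtain L R rest where
    P: "L @ s # R \<in># M" and st: "star s Z L (rev R) rest"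
    and one: "length X = 1 \<longrightarrow> length L = 1 \<and> length R = 1" .
  let ?P = "L @ s # R" and ?a = "hd Z" and ?b = "hd L" and ?c = "hd (rev R)"
  have ne: "Z \<noteq> []" "L \<noteq> []" "rev R \<noteq> []"
    using st by (auto simp: star_def)
  have mem: "?a \<in> set X" "?b \<in> set L" "?c \<in> set R"
    using ne Z(3) by (metis hd_in_set set_mset_mset, simp, metis hd_in_set set_rev)
  have "?P \<noteq> X"
    using us by auto
  then have disj: "set X \<inter> set ?P = {}"
    using path_unique[OF X(1) P] by blast
  have "distinct ?P"
    using distinct_path[OF P] .
  then have "?a \<noteq> ?b" "?a \<noteq> ?c" "?b \<noteq> ?c"
    using mem disj by auto
  then have "card {?a, ?b, ?c} = 3" by simp
  moreover have "{?a, ?b, ?c} \<subseteq> V"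
    using mem set_path[OF X(1)] set_path[OF P] by auto
  ultimately have "{?a, ?b, ?c} \<subseteq> V" "card {?a, ?b, ?c} = 3" by blast+
  moreover have "\<not> adj ?a ?b"
    using star_tip_nonadjacent[OF st] mem by blast
  moreover have "\<not> adj ?a ?c"
    using star_tip_nonadjacent[OF star_rotate[OF star_rotate[OF st]], of ?a] ne adj_sym by auto
  moreover have "\<not> adj ?b ?c"
    using star_tip_nonadjacent[OF star_rotate[OF st], of ?c] mem by simp
  moreover note star_degree_sum[OF st]
  ultimately have "{?a, ?b} \<in> D \<or> {?a, ?c} \<in> D \<or> {?b, ?c} \<in> D"
    by (rule D)
  then obtain e where "e \<in> D" "e \<subseteq> set X \<union> set ?P" "e \<inter> set ?P \<noteq> {}"
    using mem by auto
  moreover have "length ?P = 3 \<and> ?P ! 1 = s" if "length X = 1"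
    using one that by (auto simp: nth_append)
  moreover have "s \<in> set ?P" by simp
  ultimately show ?thesis
    using P by blast
qed

section \<open>Counting the spoiled pairs\<close>

lemma deficiency_eq_0:
  assumes m: "m \<ge> 1" and D: "finite D" "card D \<le> m" "\<And>e. e \<in> D \<Longrightarrow> card e = 2"
      "\<And>u v. adj u v \<Longrightarrow> {u, v} \<notin> D"
    and degree: "\<And>v. v \<in> V \<Longrightarrow> 2 * m + 1 \<le> card {w. adj v w} + card {e \<in> D. v \<in> e}"
    and spoil: "\<And>a b c. {a, b, c} \<subseteq> V \<Longrightarrow> card {a, b, c} = 3 \<Longrightarrow>
      \<not> adj a b \<Longrightarrow> \<not> adj a c \<Longrightarrow> \<not> adj b c \<Longrightarrow>
      card {w. adj a w} + card {w. adj b w} + card {w. adj c w} \<le> card V \<Longrightarrow>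
      {a, b} \<in> D \<or> {a, c} \<in> D \<or> {b, c} \<in> D"
  shows "deficiency M = 0"
proof (rule ccontr)
  assume "deficiency M \<noteq> 0"
  then obtain X where "X \<in># M" "3 - length X \<noteq> 0"
    by (auto simp: deficiency_def)
  then have X: "X \<in># M" "length X \<le> 2" by auto
  have fin: "finite {w. adj v w}" for v
    using finite_subset[OF _ finite_V] adj_V by blast
  have Xp: "path X"
    using path_mem[OF X(1)] .
  \<comment> \<open>\<open>S e\<close> contains every pair leaving \<open>X\<close> that
    \<open>e\<close> can spoil.\<close>
  define S where "S e = {(u, s). u \<in> set X \<and> adj u s \<and> s \<notin> set X \<and> (\<exists>P \<in># M. s \<in> set P \<and>
    e \<subseteq> set X \<union> set P \<and> e \<inter> set P \<noteq> {} \<and> (length X = 1 \<longrightarrow> length P = 3 \<and> P ! 1 = s))}" for e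
  let ?K = "{(u, s). u \<in> set X \<and> adj u s \<and> s \<notin> set X}"
  have K: "?K \<subseteq> (\<Union>e \<in> D. S e)"
  proof clarify
    fix u s
    assume us: "u \<in> set X" "adj u s" "s \<notin> set X"
    have "\<exists>e \<in> D. \<exists>P \<in># M. s \<in> set P \<and> e \<subseteq> set X \<union> set P \<and> e \<inter> set P \<noteq> {} \<and>
        (length X = 1 \<longrightarrow> length P = 3 \<and> P ! 1 = s)"
      by (rule spoiled_attachment[OF _ X us]) (rule spoil)
    then obtain e where "e \<in> D" "(u, s) \<in> S e"
      using us unfolding S_def by blast
    then show "(u, s) \<in> (\<Union>e \<in> D. S e)"
      by blast
  qed
  \<comment> \<open>An end of \<open>e\<close> on \<open>P\<close> lies outside \<open>X\<close>,
    and no other path of the cover contains it.\<close>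
  have same_path: "P = P'"
    if "P \<in># M" "s \<in> set P" "s \<notin> set X" "e \<inter> set P \<noteq> {}" "P' \<in># M" "e \<subseteq> set X \<union> set P'" for P P' s e
  proof -
    from that(4) obtain w where w: "w \<in> e" "w \<in> set P" by blast
    have "w \<notin> set X"
      using path_unique[OF that(1) X(1) w(2)] that(2,3) by blast
    then show ?thesis
      using path_unique[OF that(1,5) w(2)] that(6) w(1) by blast
  qed
  have fin_S: "finite (S e)" for e
    by (rule finite_subset[of _ "set X \<times> V"]) (use finite_V adj_V in \<open>auto simp: S_def\<close>)
  have card_K: "card ?K \<le> card D * B" if "\<And>e. card (S e) \<le> B" for B
  proof -
    have "card ?K \<le> card (\<Union>e \<in> D. S e)"
      using K fin_S D(1) by (intro card_mono) auto
    also have "\<dots> \<le> (\<Sum>e \<in> D. card (S e))"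
      by (rule card_UN_le[OF D(1)])
    also have "\<dots> \<le> card D * B"
      using sum_bounded_above[of D "\<lambda>e. card (S e)" B] that by simp
    finally show ?thesis .
  qed
  from X(2) Xp consider x where "X = [x]" | x y where "X = [x, y]"
    by (cases X; cases "tl X") auto
  then show False
  proof cases
    case 1
    have "card (S e) \<le> 1" for e
    proof -
      have "p = q" if pq: "p \<in> S e" "q \<in> S e" for p q
      proof -
        from pq obtain s P where s: "p = (x, s)" "P \<in># M" "s \<in> set P" "s \<notin> set X"
          "e \<subseteq> set X \<union> set P" "e \<inter> set P \<noteq> {}" "P ! 1 = s"
          using 1 unfolding S_def by auto
        from pq obtain s' P' where s': "q = (x, s')" "P' \<in># M" "s' \<in> set P'" "s' \<notin> set X"
          "e \<subseteq> set X \<union> set P'" "e \<inter> set P' \<noteq> {}" "P' ! 1 = s'"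
          using 1 unfolding S_def by auto
        have "P = P'"
          by (rule same_path) (use s s' in auto)
        then show ?thesis
          using s s' by simp
      qed
      then show ?thesis
        using fin_S by (simp add: card_le_Suc0_iff_eq)
    qed
    from card_K[OF this] have "card ?K \<le> m"
      using D(2) by simp
    moreover have "?K = {x} \<times> {w. adj x w}"
      using 1 adj_irrefl by auto
    \<comment> \<open>At most \<open>m\<close> deleted edges meet \<open>x\<close>, so at least
      \<open>m + 1\<close> neighbours remain, against at most \<open>m\<close> spoiled
      pairs.\<close>
    moreover have "card {e \<in> D. x \<in> e} \<le> m"
      using card_mono[OF D(1), of "{e \<in> D. x \<in> e}"] D(2) by auto
    moreover have "x \<in> V"
      using set_path[OF X(1)] 1 by auto
    ultimately show False
      using degree[of x] by (simp add: card_cartesian_product)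
  next
    case 2
    then have "adj x y" "adj y x"
      using Xp by (auto simp: adj_commute)
    have "x \<noteq> y"
      using \<open>adj x y\<close> adj_irrefl by blast
    have "card (S e) \<le> 2" for e
    proof (cases "S e = {}")
      case False
      then obtain s P where P: "P \<in># M" "s \<in> set P" "s \<notin> set X"
          "e \<subseteq> set X \<union> set P" "e \<inter> set P \<noteq> {}"
        unfolding S_def by blast
      have "S e \<subseteq> {(u, s). u \<in> set X \<and> s \<in> set P \<and> adj u s}" (is "_ \<subseteq> ?A")
      proof clarify
        fix u s'
        assume "(u, s') \<in> S e"
        then obtain P' where P': "u \<in> set X" "adj u s'" "P' \<in># M" "s' \<in> set P'" "s' \<notin> set X"
          "e \<subseteq> set X \<union> set P'" "e \<inter> set P' \<noteq> {}"
          unfolding S_def by blast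
        then show "u \<in> set X \<and> s' \<in> set P \<and> adj u s'"
          using same_path[OF P(1-3,5) P'(3,6)] by blast
      qed
      then have "card (S e) \<le> card ?A"
        by (rule card_mono[rotated])
          (rule finite_subset[of _ "set X \<times> set P"], auto)
      also have "\<dots> \<le> 2"
        by (rule card_attachments_le) (use P X 2 in auto)
      finally show ?thesis .
    qed simp
    from card_K[OF this] have "card ?K \<le> 2 * m"
      using D(2) by linarith
    moreover have "?K = {x} \<times> ({w. adj x w} - {y}) \<union> {y} \<times> ({w. adj y w} - {x})"
      using 2 adj_irrefl by auto
    moreover have "card \<dots> = card ({w. adj x w} - {y}) + card ({w. adj y w} - {x})"
      using fin \<open>x \<noteq> y\<close> by (subst card_Un_disjoint) (auto simp: card_cartesian_product)
    moreover have "card ({w. adj x w} - {y}) = card {w. adj x w} - 1"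
      "card ({w. adj y w} - {x}) = card {w. adj y w} - 1"
      using fin \<open>adj x y\<close> \<open>adj y x\<close> by (simp_all add: card_Diff_singleton)
    ultimately have K_le: "card {w. adj x w} - 1 + (card {w. adj y w} - 1) \<le> 2 * m"
      by simp
    \<comment> \<open>A deleted edge meeting both vertices would be the surviving edge of
      \<open>X\<close>. Hence at most \<open>m\<close> deleted edges meet \<open>X\<close>, and at
      least \<open>2 * (2 * m + 1) - m - 2 = 3 * m\<close> pairs leave it, against at most
      \<open>2 * m\<close> spoiled ones.\<close>
    have "{e \<in> D. x \<in> e} \<inter> {e \<in> D. y \<in> e} = {}"
    proof (rule ccontr)
      assume "\<not> ?thesis"
      then obtain e where e: "e \<in> D" "x \<in> e" "y \<in> e" by blast
      then have "e = {x, y}"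
        using D(3)[OF e(1)] \<open>x \<noteq> y\<close> by (auto simp: card_2_iff)
      then show False
        using D(4)[OF \<open>adj x y\<close>] e(1) by simp
    qed
    then have "card {e \<in> D. x \<in> e} + card {e \<in> D. y \<in> e}
        = card ({e \<in> D. x \<in> e} \<union> {e \<in> D. y \<in> e})"
      using D(1) by (simp add: card_Un_disjoint)
    also have "\<dots> \<le> card D"
      using D(1) by (intro card_mono) auto
    finally have "card {e \<in> D. x \<in> e} + card {e \<in> D. y \<in> e} \<le> m"
      using D(2) by simp
    moreover have "x \<in> V" "y \<in> V"
      using set_path[OF X(1)] 2 by auto
    ultimately show False
      using degree[of x] degree[of y] K_le m by linarith
  qed
qed

section \<open>From a cover without short paths to a path factor\<close>

lemma path_factor_of_cover:
  assumes V: "V = verts H" and adj: "\<And>u v. adj u v \<longleftrightarrow> {u, v} \<in> edges H"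
    and zero: "deficiency M = 0"
  shows "\<exists>K. path_factor 3 H K"
proof -
  define K where "K = Graph V {{p ! i, p ! Suc i} | p i. p \<in># M \<and> Suc i < length p}"
  have long: "3 \<le> length p" if "p \<in># M" for p
    using zero that by (auto simp: deficiency_def)
  \<comment> \<open>As paths of the cover share no vertex, an edge of \<open>K\<close> at a vertex
    of \<open>p\<close> can only come from \<open>p\<close>.\<close>
  have edge_nth: "{u, v} \<in> edges K \<longleftrightarrow> (\<exists>i. Suc i < length p \<and> {u, v} = {p ! i, p ! Suc i})"
    if p: "p \<in># M" and u: "u \<in> set p" for p u v
  proof
    assume "{u, v} \<in> edges K"
    then obtain q i where q: "q \<in># M" "Suc i < length q" "{u, v} = {q ! i, q ! Suc i}"
      unfolding K_def by auto
    then have "u \<in> set q"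
      by (metis Suc_lessD insertE insertI1 nth_mem singletonD)
    then have "q = p"
      using path_unique p u q(1) by blast
    then show "\<exists>i. Suc i < length p \<and> {u, v} = {p ! i, p ! Suc i}"
      using q by blast
  next
    assume "\<exists>i. Suc i < length p \<and> {u, v} = {p ! i, p ! Suc i}"
    then show "{u, v} \<in> edges K"
      using p unfolding K_def by auto
  qed
  let ?r = "{(x, y). {x, y} \<in> edges K}"
  have r_sym: "sym ?r"
    by (auto simp: sym_def insert_commute)
  have joined_iff: "joined K u v \<longleftrightarrow> v \<in> set p" if p: "p \<in># M" and u: "u \<in> set p" for p u v
  proof
    assume "joined K u v"
    then have "(u, v) \<in> ?r\<^sup>*"
      by (simp add: joined_def)
    then show "v \<in> set p"
    proof induction
      case base
      show ?case by (rule u)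
    next
      case (step y z)
      then obtain i where "Suc i < length p" "{y, z} = {p ! i, p ! Suc i}"
        using edge_nth[OF p] by blast
      then show ?case
        by (metis Suc_lessD insertE insertI1 insert_commute nth_mem singletonD)
    qed
  next
    assume v: "v \<in> set p"
    have "(p ! 0, p ! i) \<in> ?r\<^sup>*" if "i < length p" for i
      using that
    proof (induction i)
      case (Suc i)
      then have "(p ! i, p ! Suc i) \<in> ?r"
        using edge_nth[OF p, of "p ! i" "p ! Suc i"] by auto
      with Suc show ?case
        by (meson Suc_lessD rtrancl.rtrancl_into_rtrancl)
    qed simp
    then have from_hd: "(p ! 0, w) \<in> ?r\<^sup>*" if "w \<in> set p" for w
      using that by (metis in_set_conv_nth)
    have "(u, p ! 0) \<in> ?r\<^sup>*"
      using from_hd[OF u] sym_rtrancl[OF r_sym] by (meson symD)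
    then have "(u, v) \<in> ?r\<^sup>*"
      using from_hd[OF v] by (rule rtrancl_trans)
    then show "joined K u v"
      using set_path[OF p] u v by (auto simp: joined_def K_def)
  qed
  have iso: "graph_isomorphic (induced_subgraph K (set p)) (path_graph (length p))" if p: "p \<in># M" for p
  proof -
    have dist: "distinct p"
      using distinct_path[OF p] .
    \<comment> \<open>The isomorphism sends a vertex to its index in \<open>p\<close>, which is
      unique by distinctness.\<close>
    define f where "f = inv_into {..<length p} ((!) p)"
    have bij: "bij_betw ((!) p) {..<length p} (set p)"
      using bij_betw_nth[OF dist] by simp
    have f_nth: "f (p ! i) = i" if "i < length p" for i
      using that bij unfolding f_def bij_betw_def by (simp add: inv_into_f_f)
    have "verts (induced_subgraph K (set p)) = set p"
      using set_path[OF p] by (auto simp: induced_subgraph_def K_def)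
    moreover have "bij_betw f (set p) (verts (path_graph (length p)))"
      using bij_betw_inv_into[OF bij] by (simp add: f_def path_graph_def)
    moreover have "{u, v} \<in> edges (induced_subgraph K (set p)) \<longleftrightarrow>
        {f u, f v} \<in> edges (path_graph (length p))" if uv: "u \<in> set p" "v \<in> set p" for u v
    proof -
      from uv obtain i j where ij: "u = p ! i" "i < length p" "v = p ! j" "j < length p"
        by (metis in_set_conv_nth)
      have "{u, v} \<in> edges (induced_subgraph K (set p)) \<longleftrightarrow> {u, v} \<in> edges K"
        using uv by (auto simp: induced_subgraph_def)
      also have "\<dots> \<longleftrightarrow> (\<exists>k. Suc k < length p \<and> {u, v} = {p ! k, p ! Suc k})"
        by (rule edge_nth[OF p uv(1)])
      also have "\<dots> \<longleftrightarrow> (\<exists>k. Suc k < length p \<and> {i, j} = {k, Suc k})"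
        using ij dist by (auto simp: doubleton_eq_iff nth_eq_iff_index_eq)
      also have "\<dots> \<longleftrightarrow> {f u, f v} \<in> edges (path_graph (length p))"
        using ij by (auto simp: path_graph_def f_nth)
      finally show ?thesis .
    qed
    ultimately show ?thesis
      unfolding graph_isomorphic_def by metis
  qed
  have "path_factor 3 H K"
    unfolding path_factor_def
  proof (intro conjI ballI)
    have "{p ! i, p ! Suc i} \<in> edges H" if "p \<in># M" "Suc i < length p" for p i
      using path_mem[OF that(1)] that(2) adj by (auto simp: successively_conv_nth)
    then show "spanning_subgraph K H"
      using V by (auto simp: spanning_subgraph_def K_def)
  next
    fix C
    assume "C \<in> graph_components K"
    then obtain u where u: "u \<in> V" "C = induced_subgraph K {v. joined K u v}"
      by (auto simp: graph_components_def K_def)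
    obtain p where p: "p \<in># M" "u \<in> set p"
      using path_containing[OF u(1)] by blast
    then have "C = induced_subgraph K (set p)"
      using u joined_iff[OF p] by simp
    then show "\<exists>l\<ge>3. graph_isomorphic C (path_graph l)"
      using iso[OF p(1)] long[OF p(1)] by blast
  qed
  then show ?thesis by blast
qed

end

section \<open>Existence of an optimal cover\<close>

text \<open>Single vertices form a path cover, and a natural-valued deficiency attains its
  minimum.\<close>

lemma ex_optimal_path_cover:
  assumes "finite V" "\<And>u v. adj u v \<Longrightarrow> adj v u" "\<And>v. \<not> adj v v" "\<And>u v. adj u v \<Longrightarrow> v \<in> V"
  shows "\<exists>M. optimal_path_cover V adj M"
proof -
  have "\<Sum>\<^sub># (image_mset mset (image_mset (\<lambda>v. [v]) N)) = N" for N :: "'a multiset"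
    by (induction N) auto
  from this[of "mset_set V"] have "path_cover adj V (image_mset (\<lambda>v. [v]) (mset_set V))"
    unfolding path_cover_def by simp
  then have "\<exists>M. path_cover adj V M \<and> (\<forall>N. path_cover adj V N \<longrightarrow> deficiency M \<le> deficiency N)"
    by (rule ex_has_least_nat)
  then obtain M where "path_cover adj V M" "\<And>N. path_cover adj V N \<Longrightarrow> deficiency M \<le> deficiency N"
    by blast
  then have "optimal_path_cover V adj M"
    using assms unfolding optimal_path_cover_def by blast
  then show ?thesis by blast
qed

section \<open>Degrees, connectivity and degree sums\<close>

text \<open>Degrees are defined by incident edges, while the exchange arguments count
  neighbours.\<close>

lemma degree_eq_card_neighbors:
  assumes "\<And>e. e \<in> F \<Longrightarrow> card e = 2"
  shows "card {e \<in> F. x \<in> e} = card {w. {x, w} \<in> F}"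
proof -
  have "bij_betw (\<lambda>w. {x, w}) {w. {x, w} \<in> F} {e \<in> F. x \<in> e}"
    unfolding bij_betw_def
  proof (intro conjI inj_onI)
    have "\<exists>w. e = {x, w}" if e: "e \<in> F" "x \<in> e" for e
    proof -
      from assms[OF e(1)] obtain a b where "e = {a, b}"
        by (auto simp: card_2_iff)
      with e(2) show ?thesis by blast
    qed
    then show "(\<lambda>w. {x, w}) ` {w. {x, w} \<in> F} = {e \<in> F. x \<in> e}"
      by blast
  qed (auto simp: doubleton_eq_iff)
  then show ?thesis
    by (simp add: bij_betw_same_card)
qed

lemma edge_properties:
  assumes "finite_simple_graph G" "e \<in> edges G"
  shows "card e = 2" "e \<subseteq> verts G"
  using assms by (auto simp: finite_simple_graph_def nsets_def)

text \<open>The neighbours of \<open>x\<close> form a cut unless \<open>x\<close> is adjacent to all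
  other vertices. In that case removing all but two nonadjacent vertices gives a cut of
  \<open>n - 2\<close> vertices, below the degree \<open>n - 1\<close> of \<open>x\<close>.\<close>

lemma vertex_connectivity_le_degree:
  assumes G: "finite_simple_graph G" and not_clique: "\<not> clique (verts G) (edges G)"
    and x: "x \<in> verts G"
  shows "vertex_connectivity G \<le> vertex_degree G x"
proof -
  have fin: "finite (verts G)"
    using G by (simp add: finite_simple_graph_def)
  let ?N = "{w. {x, w} \<in> edges G}"
  have N: "?N \<subseteq> verts G - {x}"
    using edge_properties[OF G] by fastforce
  have deg: "vertex_degree G x = card ?N"
    unfolding vertex_degree_def by (rule degree_eq_card_neighbors) (rule edge_properties[OF G])
  \<comment> \<open>Removing \<open>S\<close> isolates \<open>u\<close> while \<open>v\<close>
    remains, so the rest is disconnected.\<close>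
  have cut: "vertex_connectivity G \<le> card S"
    if S: "S \<subseteq> verts G" "u \<in> verts G - S" "v \<in> verts G - S" "u \<noteq> v"
      "\<And>w. w \<in> verts G - S \<Longrightarrow> {u, w} \<notin> edges G" for S u v
  proof -
    let ?K = "delete_vertices G S"
    have "\<not> joined ?K u v"
    proof
      assume "joined ?K u v"
      then have "(u, v) \<in> {(x, y). {x, y} \<in> edges ?K}\<^sup>*"
        by (simp add: joined_def)
      then show False
        using S by (cases rule: converse_rtranclE) (auto simp: delete_vertices_def induced_subgraph_def)
    qed
    then have "\<not> graph_connected ?K"
      using S by (auto simp: graph_connected_def delete_vertices_def induced_subgraph_def)
    moreover have "finite {card S | S. S \<subseteq> verts G \<and> \<not> graph_connected (delete_vertices G S)}"
      by (rule finite_subset[of _ "card ` Pow (verts G)"]) (use fin in auto)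
    ultimately show ?thesis
      using S(1) not_clique unfolding vertex_connectivity_def by (auto intro!: Min_le)
  qed
  show ?thesis
  proof (cases "?N = verts G - {x}")
    case False
    then obtain v where "v \<in> verts G" "v \<noteq> x" "v \<notin> ?N"
      using N by blast
    then have "vertex_connectivity G \<le> card ?N"
      using N x by (intro cut[of ?N x v]) blast+
    then show ?thesis
      by (simp only: deg)
  next
    case True
    obtain u v where uv: "u \<in> verts G" "v \<in> verts G" "u \<noteq> v" "{u, v} \<notin> edges G"
      using not_clique by (auto simp: clique_def)
    have "{u, u} \<notin> edges G"
      using edge_properties(1)[OF G, of "{u, u}"] by auto
    then have "vertex_connectivity G \<le> card (verts G - {u, v})"
      using uv by (intro cut[of _ u v]) auto
    also have "\<dots> \<le> card (verts G - {x})"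
      using uv x fin by (simp add: card_Diff_subset)
    finally show ?thesis
      using True deg by simp
  qed
qed

lemma degree_sum_le:
  assumes G: "finite_simple_graph G" and X: "independent_set G X" "card X = k"
  shows "degree_sum k G \<le> (\<Sum>x\<in>X. vertex_degree G x)"
proof -
  have "finite {\<Sum>x\<in>X. vertex_degree G x | X. independent_set G X \<and> card X = k}"
    by (rule finite_subset[of _ "(\<lambda>X. \<Sum>x\<in>X. vertex_degree G x) ` Pow (verts G)"])
      (use G in \<open>auto simp: finite_simple_graph_def independent_set_def\<close>)
  then show ?thesis
    unfolding degree_sum_def using X by (auto intro!: Min_le)
qed

section \<open>The degree conditions after the deletion of \<open>m\<close> edges\<close>

theorem theorem9:
  fixes G :: "'a ugraph" and m n :: nat
  assumes "m \<ge> 1"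
    and "finite_simple_graph G"
    and "graph_order G = n"
    and "\<exists>X. independent_set G X \<and> card X = 3"
    and "vertex_connectivity G \<ge> 2 * m + 1"
    and "degree_sum 3 G \<ge> n + 2 * m"
  shows "path_factor_deleted_graph 3 m G"
  unfolding path_factor_deleted_graph_def
proof (intro allI impI)
  fix D
  assume "D \<subseteq> edges G \<and> card D = m"
  then have D: "D \<subseteq> edges G" "card D = m" by auto
  note G = assms(2)
  have fin: "finite (verts G)"
    using G by (simp add: finite_simple_graph_def)
  \<comment> \<open>An infinite set has \<open>card\<close> 0, which \<open>m \<ge> 1\<close> rules
    out.\<close>
  have fin_D: "finite D"
    using D assms(1) by (metis card.infinite not_one_le_zero)
  define H where "H = delete_edges G D"
  have H: "verts H = verts G" "edges H = edges G - D"
    by (simp_all add: H_def delete_edges_def)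
  define adj where "adj u v \<longleftrightarrow> {u, v} \<in> edges H" for u v
  have card_e: "card e = 2" if "e \<in> edges G" for e
    using edge_properties[OF G that] by blast
  obtain M where "optimal_path_cover (verts G) adj M"
  proof -
    have "\<exists>M. optimal_path_cover (verts G) adj M"
      using fin edge_properties[OF G]
      by (intro ex_optimal_path_cover) (fastforce simp: adj_def H insert_commute)+
    then show thesis using that by blast
  qed
  then interpret optimal_path_cover "verts G" adj M .
  have degree: "vertex_degree G x = card {w. adj x w} + card {e \<in> D. x \<in> e}" for x
  proof -
    have "{e \<in> edges G. x \<in> e} = {e \<in> edges H. x \<in> e} \<union> {e \<in> D. x \<in> e}"
      using D H by auto
    moreover have "finite (edges G)"
      using finite_subset[of "edges G" "Pow (verts G)"] fin edge_properties(2)[OF G] by blast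
    ultimately have "vertex_degree G x = card {e \<in> edges H. x \<in> e} + card {e \<in> D. x \<in> e}"
      using fin_D H unfolding vertex_degree_def by (simp add: card_Un_disjoint disjoint_iff)
    then show ?thesis
      using degree_eq_card_neighbors[of "edges H" x] card_e H by (simp add: adj_def)
  qed
  \<comment> \<open>Selects the branch of \<open>vertex_connectivity\<close> that is defined by
    cuts.\<close>
  have not_clique: "\<not> clique (verts G) (edges G)"
  proof
    assume clique: "clique (verts G) (edges G)"
    obtain X where X: "independent_set G X" "card X = 3"
      using assms(4) by blast
    then obtain a b where "a \<in> X" "b \<in> X" "a \<noteq> b"
      by (auto simp: card_3_iff)
    then show False
      using X clique unfolding independent_set_def indep_def clique_def by blast
  qed
  have "deficiency M = 0"
  proof (rule deficiency_eq_0)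
    show "2 * m + 1 \<le> card {w. adj v w} + card {e \<in> D. v \<in> e}" if "v \<in> verts G" for v
      using vertex_connectivity_le_degree[OF G not_clique that] assms(5) degree[of v] by simp
  next
    fix a b c
    assume abc: "{a, b, c} \<subseteq> verts G" "card {a, b, c} = 3" "\<not> adj a b" "\<not> adj a c" "\<not> adj b c"
      and le: "card {w. adj a w} + card {w. adj b w} + card {w. adj c w} \<le> card (verts G)"
    from abc(2) have ne: "a \<noteq> b" "a \<noteq> c" "b \<noteq> c"
      by (auto simp: card_insert_if split: if_splits)
    show "{a, b} \<in> D \<or> {a, c} \<in> D \<or> {b, c} \<in> D"
    proof (rule ccontr)
      assume "\<not> ?thesis"
      then have ind: "{a, b} \<notin> edges G" "{a, c} \<notin> edges G" "{b, c} \<notin> edges G"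
        using abc by (auto simp: adj_def H)
      then have "independent_set G {a, b, c}"
        using abc(1) by (auto simp: independent_set_def indep_def insert_commute)
      then have "n + 2 * m \<le> (\<Sum>x\<in>{a, b, c}. vertex_degree G x)"
        using degree_sum_le[OF G _ abc(2)] assms(6) by linarith
      also have "\<dots> = vertex_degree G a + vertex_degree G b + vertex_degree G c"
        using ne by simp
      also have "\<dots> \<le> n + (card {e \<in> D. a \<in> e} + card {e \<in> D. b \<in> e} + card {e \<in> D. c \<in> e})"
        using le assms(3) by (simp add: degree graph_order_def)
      also have "card {e \<in> D. a \<in> e} + card {e \<in> D. b \<in> e} + card {e \<in> D. c \<in> e} \<le> m"
      proof -
        \<comment> \<open>The three vertices are independent in \<open>G\<close>, so each deleted
          edge meets at most one of them. This bounds the degree sum in \<open>G\<close> by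
          \<open>n + m\<close>, which is less than \<open>n + 2 * m\<close>.\<close>
        have disj: "{e \<in> D. u \<in> e} \<inter> {e \<in> D. v \<in> e} = {}" if "u \<noteq> v" "{u, v} \<notin> edges G" for u v
        proof (rule ccontr)
          assume "\<not> ?thesis"
          then obtain e where e: "e \<in> D" "u \<in> e" "v \<in> e" by blast
          then have "e = {u, v}"
            using card_e[of e] D(1) that(1) by (auto simp: card_2_iff)
          then show False
            using e D(1) that(2) by blast
        qed
        have "card {e \<in> D. a \<in> e} + card {e \<in> D. b \<in> e} + card {e \<in> D. c \<in> e}
            = card ({e \<in> D. a \<in> e} \<union> {e \<in> D. b \<in> e} \<union> {e \<in> D. c \<in> e})"
          using disj[OF ne(1) ind(1)] disj[OF ne(2) ind(2)] disj[OF ne(3) ind(3)] fin_D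
          by (simp add: card_Un_disjoint Int_Un_distrib2)
        also have "\<dots> \<le> card D"
          using fin_D by (intro card_mono) auto
        finally show ?thesis
          using D(2) by simp
      qed
      finally show False
        using assms(1) by simp
    qed
  qed (use assms(1) D fin_D card_e in \<open>auto simp: adj_def H\<close>)
  then show "\<exists>K. path_factor 3 (delete_edges G D) K"
    using path_factor_of_cover[of H] H by (simp add: adj_def H_def)
qed

end
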